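(* For any integer $k$ with $1\le k\le N-1$, there exists $\beta_k>0$ such that if $\beta>\beta_k$, then every global minimizer $\hat x$ of $\mathcal F_\beta(x)=x^\top D x+\beta\|x\|_0$ over $\mathcal X$ satisfies $\|\hat x\|_0\le k$.
   Context: Data: $N\ge 1$; $D\in\mathbb R^{N\times N}$ is a symmetric positive definite matrix with diagonal entries $D_{ii}$; $\hat r\in\mathbb R^N$; $r_c,\bar r\in\mathbb R$; $\gamma>0$. Set $\mathfrak r=\hat r-r_c\mathbf 1\in\mathbb R^N$ (with entries $\mathfrak r[i]$, where $\mathbf 1$ is the all-ones vector) and $\bar{\mathfrak r}=\bar r-r_c$. Notation: $\|x\|_D=\sqrt{x^\top D x}$; $\|x\|_0$ is the number of nonzero entries of $x$. The feasible set is $\mathcal X=\{x\in\mathbb R^N:\ \mathfrak r^\top x-\gamma\|x\|_D\ge\bar{\mathfrak r}\}$. Standing assumptions: (1) $\bar r>r_c$, i.e. $\bar{\mathfrak r}>0$; (2) $\min_{1\le i\le N}|\mathfrak r[i]|/\sqrt{D_{ii}}>\gamma$. *)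

theory Defs
  imports "HOL-Analysis.Analysis"
begin

definition sym_pos_def :: "real ^ 'n ^ 'n \<Rightarrow> bool" where
  "sym_pos_def D \<longleftrightarrow> transpose D = D \<and> (\<forall>x. x \<noteq> 0 \<longrightarrow> x \<bullet> (D *v x) > 0)"

definition mat_norm :: "real ^ 'n ^ 'n \<Rightarrow> real ^ 'n \<Rightarrow> real" where
  "mat_norm D x = sqrt (x \<bullet> (D *v x))"

definition l0_norm :: "real ^ 'n \<Rightarrow> nat" where
  "l0_norm x = card {i. x $ i \<noteq> 0}"

definition excess_vec :: "real ^ 'n \<Rightarrow> real \<Rightarrow> real ^ 'n" where
  "excess_vec rhat rc = rhat - rc *\<^sub>R vec 1"

definition feasible_set ::
  "real ^ 'n ^ 'n \<Rightarrow> real ^ 'n \<Rightarrow> real \<Rightarrow> real \<Rightarrow> real \<Rightarrow> (real ^ 'n) set" where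
  "feasible_set D rhat rc rbar \<gamma> =
     {x. excess_vec rhat rc \<bullet> x - \<gamma> * mat_norm D x \<ge> rbar - rc}"

definition objective :: "real ^ 'n ^ 'n \<Rightarrow> real \<Rightarrow> real ^ 'n \<Rightarrow> real" where
  "objective D \<beta> x = x \<bullet> (D *v x) + \<beta> * real (l0_norm x)"

end

theory Submission
  imports Defs
begin

text \<open>
  Some feasible point has a single nonzero entry: moving along the coordinate axis \<open>i\<close>
  in the direction of the sign of \<open>r = excess_vec rhat rc\<close>, each unit of length gains
  \<open>\<bar>r $ i\<bar> - \<gamma> sqrt (D $ i $ i)\<close> in the constraint, and the assumed lower bound on the
  ratios \<open>\<bar>r $ i\<bar> / sqrt (D $ i $ i)\<close> makes this gain positive
  (\<open>exists_feasible_single_support\<close>). Let \<open>c\<close> be the value of the quadratic form at such a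
  point. A minimizer cannot have objective value above \<open>c + \<beta>\<close>, while a point with at least
  two nonzero entries has objective value at least \<open>2 \<beta>\<close>. Hence \<open>\<beta>\<^sub>k = c\<close> works, and it
  even forces at most one nonzero entry, uniformly in \<open>k\<close>
  (\<open>minimizer_l0_norm_le_one\<close>).
\<close>

lemma quadratic_form_axis:
  fixes D :: "real ^ 'n ^ 'n"
  shows "axis i s \<bullet> (D *v axis i s) = s\<^sup>2 * D $ i $ i"
proof -
  have "(D *v axis i s) $ i = D $ i $ i * s"
    by (simp add: matrix_vector_mult_def axis_def if_distrib cong: if_cong)
  then show ?thesis
    by (simp add: inner_axis' power2_eq_square)
qed

lemma l0_norm_axis:
  assumes "s \<noteq> 0"
  shows "l0_norm (axis i s) = 1"
proof -
  have "{j. axis i s $ j \<noteq> 0} = {i}"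
    using assms by (auto simp: axis_def)
  then show ?thesis
    by (simp add: l0_norm_def)
qed

lemma sym_pos_def_diagonal_pos:
  assumes "sym_pos_def D"
  shows "D $ i $ i > 0"
proof -
  have "axis i 1 \<bullet> (D *v axis i 1) > 0"
    using assms by (simp add: sym_pos_def_def axis_eq_0_iff)
  then show ?thesis
    by (simp add: quadratic_form_axis)
qed

lemma sym_pos_def_quadratic_form_nonneg:
  assumes "sym_pos_def D"
  shows "x \<bullet> (D *v x) \<ge> 0"
  using assms by (cases "x = 0") (auto simp: sym_pos_def_def less_imp_le)

text \<open>
  The constraint function is positively homogeneous, so one axis direction on which it is
  positive reaches every level, in particular the positive level \<open>rbar - rc\<close>.
\<close>

lemma exists_feasible_single_support:
  assumes D: "sym_pos_def D"
    and level: "rbar > rc"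
    and ratio: "\<bar>excess_vec rhat rc $ i\<bar> / sqrt (D $ i $ i) > \<gamma>"
  shows "\<exists>y \<in> feasible_set D rhat rc rbar \<gamma>. l0_norm y = 1"
proof -
  define a where "a = excess_vec rhat rc $ i"
  define d where "d = sqrt (D $ i $ i)"
  have d: "d > 0"
    using sym_pos_def_diagonal_pos[OF D] by (simp add: d_def)
  have gain: "\<bar>a\<bar> - \<gamma> * d > 0"
    using ratio d by (simp add: a_def[symmetric] d_def[symmetric] pos_less_divide_eq)
  define t where "t = (rbar - rc) / (\<bar>a\<bar> - \<gamma> * d)"
  have t: "t > 0"
    using gain level by (simp add: t_def)
  \<comment> \<open>The sign is chosen by cases because \<open>sgn 0 = 0\<close> would give the zero vector.\<close>
  define s where "s = (if a \<ge> 0 then t else - t)"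
  have s: "s \<noteq> 0" "\<bar>s\<bar> = t" "a * s = \<bar>a\<bar> * t"
    using t by (auto simp: s_def)
  have "excess_vec rhat rc \<bullet> axis i s = \<bar>a\<bar> * t"
    using s(3) by (simp add: inner_axis a_def)
  moreover have "mat_norm D (axis i s) = t * d"
    by (simp add: mat_norm_def quadratic_form_axis real_sqrt_mult d_def s(2))
  moreover have "t * (\<bar>a\<bar> - \<gamma> * d) = rbar - rc"
    using gain by (simp add: t_def)
  ultimately have "axis i s \<in> feasible_set D rhat rc rbar \<gamma>"
    by (simp add: feasible_set_def algebra_simps)
  with l0_norm_axis[OF s(1)] show ?thesis
    by blast
qed

text \<open>
  Against a competitor with one nonzero entry, every further nonzero entry of a minimizer
  costs \<open>\<beta>\<close> and can save at most the quadratic value of the competitor.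
\<close>

lemma minimizer_l0_norm_le_one:
  assumes D: "sym_pos_def D"
    and min: "is_arg_min (objective D \<beta>) P x"
    and y: "P y" "l0_norm y = 1"
    and \<beta>: "\<beta> > y \<bullet> (D *v y)"
  shows "l0_norm x \<le> 1"
proof (rule ccontr)
  assume "\<not> l0_norm x \<le> 1"
  then have two: "2 \<le> real (l0_norm x)"
    by simp
  have "\<beta> \<ge> 0"
    using \<beta> sym_pos_def_quadratic_form_nonneg[OF D, of y] by linarith
  then have "\<beta> * 2 \<le> \<beta> * real (l0_norm x)"
    using two by (rule mult_left_mono[rotated])
  also have "\<dots> \<le> objective D \<beta> x"
    using sym_pos_def_quadratic_form_nonneg[OF D] by (simp add: objective_def)
  also have "\<dots> \<le> objective D \<beta> y"
    using min y(1) by (auto simp: is_arg_min_def not_less)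
  also have "\<dots> = y \<bullet> (D *v y) + \<beta>"
    by (simp add: objective_def y(2))
  finally show False
    using \<beta> by linarith
qed

theorem proposition6:
  fixes D :: "real ^ 'n ^ 'n" and rhat :: "real ^ 'n"
    and rc rbar \<gamma> :: real and k :: nat
  assumes "sym_pos_def D"
    and "\<gamma> > 0"
    and "rbar > rc"
    and "(MIN i. \<bar>excess_vec rhat rc $ i\<bar> / sqrt (D $ i $ i)) > \<gamma>"
    and "1 \<le> k" and "k \<le> CARD('n) - 1"
  shows "\<exists>\<beta>k > 0. \<forall>\<beta> > \<beta>k. \<forall>xhat.
           is_arg_min (objective D \<beta>) (\<lambda>x. x \<in> feasible_set D rhat rc rbar \<gamma>) xhat
             \<longrightarrow> l0_norm xhat \<le> k"
proof -
  fix i :: 'n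
  have "\<bar>excess_vec rhat rc $ i\<bar> / sqrt (D $ i $ i) > \<gamma>"
    using assms(4) by (simp add: Min_gr_iff)
  then obtain y where y: "y \<in> feasible_set D rhat rc rbar \<gamma>" "l0_norm y = 1"
    using exists_feasible_single_support[OF assms(1,3)] by blast
  have "y \<noteq> 0"
    using y(2) by (auto simp: l0_norm_def)
  then have "y \<bullet> (D *v y) > 0"
    using assms(1) by (simp add: sym_pos_def_def)
  moreover have "l0_norm xhat \<le> k"
    if "\<beta> > y \<bullet> (D *v y)"
      and "is_arg_min (objective D \<beta>) (\<lambda>x. x \<in> feasible_set D rhat rc rbar \<gamma>) xhat"
    for \<beta> xhat
    using minimizer_l0_norm_le_one[OF assms(1) that(2) y that(1)] assms(5) by linarith
  ultimately show ?thesis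
    by blast
qed

end
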